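(* Let $m,n\ge 1$ be integers, let $p_1,\dots,p_m>0$ with $\sum_{i=1}^m p_i=1$, and let $Y=(Y_1,\dots,Y_n)$ be a vector of i.i.d. random variables with $P(Y_j=i)=p_i$ for all $i\in[m]$ and $j\in[n]$. Let $\mathcal N_n$ be the empirical nerve of $Y$, and let $\omega$ be the clique number of $\mathcal N_n$, i.e. the size (number of vertices) of the largest clique in the 1-skeleton of $\mathcal N_n$. Then, with $q_i=1-p_i$, $$\mathbb E\,\omega\ \ge\ \sum_{i=1}^m\left(1-q_i^{\lceil n/2\rceil}-q_i^{\,n-\lceil n/2\rceil+1}+q_i^{\,n}\right).$$ Moreover, in the uniform case where $p_i=\frac1m$ for all $i\in[m]$, $$\mathbb E\,\omega\ \ge\ m\left(1-\Big(\tfrac{m-1}{m}\Big)^{\lceil n/2\rceil}-\Big(\tfrac{m-1}{m}\Big)^{n-\lceil n/2\rceil+1}+\Big(\tfrac{m-1}{m}\Big)^{n}\right).$$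
   Context: Notation: $[N]=\{1,\dots,N\}$. For each label $i\in[m]$, the empirical support is $I_n(i)=\mathrm{Conv}(\{j\in[n]:Y_j=i\})\subset\mathbb R$, i.e. the closed interval from the first to the last index at which label $i$ occurs (possibly a single point; empty if label $i$ does not occur). The empirical nerve $\mathcal N_n$ is the abstract simplicial complex whose simplices are the nonempty subsets $J\subseteq[m]$ with $\bigcap_{i\in J}I_n(i)\ne\emptyset$; its 1-skeleton is the graph whose vertices are the labels $i$ with $I_n(i)\neq\emptyset$ and in which $\{i,j\}$, $i\ne j$, is an edge iff $I_n(i)\cap I_n(j)\neq\emptyset$. *)

theory Defs
  imports "HOL-Probability.Probability"
begin

definition empirical_support :: "nat \<Rightarrow> (nat \<Rightarrow> nat) \<Rightarrow> nat \<Rightarrow> real set" where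
  "empirical_support n y i = convex hull (real ` {j \<in> {1..n}. y j = i})"

text \<open>An abstract simplicial complex is represented by its set of simplices.\<close>

definition empirical_nerve :: "nat \<Rightarrow> nat \<Rightarrow> (nat \<Rightarrow> nat) \<Rightarrow> nat set set" where
  "empirical_nerve m n y =
     {J. J \<subseteq> {1..m} \<and> J \<noteq> {} \<and> (\<Inter>i\<in>J. empirical_support n y i) \<noteq> {}}"

definition skeleton_verts :: "'v set set \<Rightarrow> 'v set" where
  "skeleton_verts K = {v. {v} \<in> K}"

definition skeleton_edges :: "'v set set \<Rightarrow> 'v set set" where
  "skeleton_edges K = {e \<in> K. card e = 2}"

definition is_clique :: "'v set \<Rightarrow> 'v set set \<Rightarrow> 'v set \<Rightarrow> bool" where
  "is_clique V E C \<longleftrightarrow> C \<subseteq> V \<and> (\<forall>u\<in>C. \<forall>v\<in>C. u \<noteq> v \<longrightarrow> {u, v} \<in> E)"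

text \<open>The maximum is meaningful for complexes with finitely many vertices, such as the
  empirical nerve; the empty set counts as a clique.\<close>

definition clique_number :: "'v set set \<Rightarrow> nat" where
  "clique_number K = Max (card ` {C. is_clique (skeleton_verts K) (skeleton_edges K) C})"

lemma skeleton_verts_empirical_nerve:
  "skeleton_verts (empirical_nerve m n y) = {i \<in> {1..m}. empirical_support n y i \<noteq> {}}"
  by (auto simp: skeleton_verts_def empirical_nerve_def)

lemma edge_empirical_nerve_iff:
  assumes "i \<in> {1..m}" "k \<in> {1..m}" "i \<noteq> k"
  shows "{i, k} \<in> skeleton_edges (empirical_nerve m n y) \<longleftrightarrow>
           empirical_support n y i \<inter> empirical_support n y k \<noteq> {}"
  using assms by (auto simp: skeleton_edges_def empirical_nerve_def)

end

theory Submission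
  imports Defs
begin

text \<open>Put \<open>k = \<lceil>n/2\<rceil>\<close>. The labels whose support contains the point \<open>k\<close> form a clique, and a label
  has this property as soon as it occurs both among the indices \<open>1..k\<close> and among \<open>k..n\<close>. By
  inclusion-exclusion this happens with probability
  \<open>1 - q\<^sub>i ^ k - q\<^sub>i ^ (n - k + 1) + q\<^sub>i ^ n\<close>, because the two index ranges cover \<open>1..n\<close>; the bound
  follows by linearity of expectation.\<close>

section \<open>Supports and cliques of the nerve of a fixed sequence\<close>

lemma empirical_support_cong:
  assumes "\<And>j. j \<in> {1..n} \<Longrightarrow> y j = z j"
  shows "empirical_support n y = empirical_support n z"
proof
  fix i
  have "{j \<in> {1..n}. y j = i} = {j \<in> {1..n}. z j = i}"
    using assms by auto
  then show "empirical_support n y i = empirical_support n z i"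
    by (simp only: empirical_support_def)
qed

text \<open>This is what lets \<open>y\<close> be replaced by its restriction to
  \<open>{1..n}\<close>, so that the clique number becomes a function on a finite product
  space.\<close>

lemma empirical_nerve_cong:
  assumes "\<And>j. j \<in> {1..n} \<Longrightarrow> y j = z j"
  shows "empirical_nerve m n y = empirical_nerve m n z"
  using empirical_support_cong[OF assms] by (simp add: empirical_nerve_def)

lemma mem_empirical_support:
  assumes "a \<in> {1..n}" "b \<in> {1..n}" "y a = i" "y b = i" "real a \<le> t" "t \<le> real b"
  shows "t \<in> empirical_support n y i"
proof -
  have "t \<in> closed_segment (real a) (real b)"
    using assms by (simp add: closed_segment_eq_real_ivl)
  also have "closed_segment (real a) (real b) \<subseteq> empirical_support n y i"
    unfolding empirical_support_def using assms
    by (intro closed_segment_subset_convex_hull hull_inc) auto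
  finally show ?thesis .
qed

text \<open>Any two of these supports meet, since both contain \<open>t\<close>; this already gives
  every edge.\<close>

lemma is_clique_common_point:
  "is_clique (skeleton_verts (empirical_nerve m n y)) (skeleton_edges (empirical_nerve m n y))
     {i \<in> {1..m}. t \<in> empirical_support n y i}"
  unfolding is_clique_def
proof (intro conjI ballI impI)
  show "{i \<in> {1..m}. t \<in> empirical_support n y i} \<subseteq> skeleton_verts (empirical_nerve m n y)"
    by (auto simp: skeleton_verts_empirical_nerve)
next
  fix u v
  assume "u \<in> {i \<in> {1..m}. t \<in> empirical_support n y i}"
    "v \<in> {i \<in> {1..m}. t \<in> empirical_support n y i}" "u \<noteq> v"
  then show "{u, v} \<in> skeleton_edges (empirical_nerve m n y)"
    by (subst edge_empirical_nerve_iff) auto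
qed

lemma finite_cliques:
  assumes "finite V"
  shows "finite {C. is_clique V E C}"
  by (rule finite_subset[of _ "Pow V"]) (use assms in \<open>auto simp: is_clique_def\<close>)

lemma card_le_clique_number:
  assumes "finite (skeleton_verts K)" "is_clique (skeleton_verts K) (skeleton_edges K) C"
  shows "card C \<le> clique_number K"
  unfolding clique_number_def using assms by (intro Max_ge finite_imageI finite_cliques) auto

lemma clique_number_le_card_verts:
  assumes "finite (skeleton_verts K)"
  shows "clique_number K \<le> card (skeleton_verts K)"
  unfolding clique_number_def
proof (rule Max.boundedI)
  show "finite (card ` {C. is_clique (skeleton_verts K) (skeleton_edges K) C})"
    using assms by (intro finite_imageI finite_cliques)
  \<comment> \<open>\<open>Max\<close> is only controlled on a nonempty set; the empty clique is
    available even when \<open>K\<close> has no vertices.\<close>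
  have "is_clique (skeleton_verts K) (skeleton_edges K) {}"
    by (simp add: is_clique_def)
  then show "card ` {C. is_clique (skeleton_verts K) (skeleton_edges K) C} \<noteq> {}"
    by blast
qed (use assms in \<open>auto simp: is_clique_def intro: card_mono\<close>)

lemma finite_skeleton_verts_empirical_nerve:
  "finite (skeleton_verts (empirical_nerve m n y))"
  by (simp add: skeleton_verts_empirical_nerve)

text \<open>A bound uniform in \<open>y\<close>, which later makes the random clique number
  integrable.\<close>

lemma clique_number_empirical_nerve_le: "clique_number (empirical_nerve m n y) \<le> m"
proof -
  have "card (skeleton_verts (empirical_nerve m n y)) \<le> card {1..m}"
    by (intro card_mono) (auto simp: skeleton_verts_empirical_nerve)
  then show ?thesis
    using clique_number_le_card_verts[OF finite_skeleton_verts_empirical_nerve, of m n y] by simp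
qed

lemma clique_number_empirical_nerve_ge:
  assumes "k \<in> {1..n}"
  shows "card {i \<in> {1..m}. (\<exists>a\<in>{1..k}. y a = i) \<and> (\<exists>b\<in>{k..n}. y b = i)}
           \<le> clique_number (empirical_nerve m n y)"
proof -
  have "card {i \<in> {1..m}. (\<exists>a\<in>{1..k}. y a = i) \<and> (\<exists>b\<in>{k..n}. y b = i)}
      \<le> card {i \<in> {1..m}. real k \<in> empirical_support n y i}"
  proof (intro card_mono subsetI CollectI conjI)
    fix i
    assume "i \<in> {i \<in> {1..m}. (\<exists>a\<in>{1..k}. y a = i) \<and> (\<exists>b\<in>{k..n}. y b = i)}"
    then obtain a b where "a \<in> {1..k}" "y a = i" "b \<in> {k..n}" "y b = i"
      by blast
    \<comment> \<open>Here \<open>a \<le> k \<le> b\<close>, so the interval spanned by these two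
      occurrences contains \<open>k\<close>. Both ranges include \<open>k\<close>, so
      \<open>a = b = k\<close> is possible.\<close>
    then show "real k \<in> empirical_support n y i"
      using assms by (intro mem_empirical_support[of a n b]) auto
  qed auto
  also have "\<dots> \<le> clique_number (empirical_nerve m n y)"
    by (intro card_le_clique_number finite_skeleton_verts_empirical_nerve is_clique_common_point)
  finally show ?thesis .
qed

section \<open>Probabilities of avoiding or hitting a value\<close>

lemma (in prob_space) prob_avoid_value:
  assumes indep: "indep_vars (\<lambda>_. count_space V) Y I" and "J \<subseteq> I" "finite J" "v \<in> V"
    and p: "\<And>j. j \<in> J \<Longrightarrow> prob {x \<in> space M. Y j x = v} = p"
  shows "prob {x \<in> space M. \<forall>j\<in>J. Y j x \<noteq> v} = (1 - p) ^ card J"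
\<comment> \<open>Independence yields the product formula for nonempty index sets only, and an empty
  intersection would be \<open>UNIV\<close> instead of \<open>space M\<close>.\<close>
proof (cases "J = {}")
  case True
  then show ?thesis by (simp add: prob_space)
next
  case False
  have meas: "Y j \<in> measurable M (count_space V)" if "j \<in> J" for j
    using indep that \<open>J \<subseteq> I\<close> by (auto simp: indep_vars_def)
  \<comment> \<open>Measurability into \<open>count_space V\<close> forces the values into
    \<open>V\<close>, so avoiding \<open>v\<close> means landing in \<open>V - {v}\<close>.\<close>
  have "{x \<in> space M. \<forall>j\<in>J. Y j x \<noteq> v} = (\<Inter>j\<in>J. Y j -` (V - {v}) \<inter> space M)"
    using False measurable_space[OF meas] by fastforce
  then have "prob {x \<in> space M. \<forall>j\<in>J. Y j x \<noteq> v} = (\<Prod>j\<in>J. prob (Y j -` (V - {v}) \<inter> space M))"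
    using indep_varsD[OF indep False \<open>finite J\<close> \<open>J \<subseteq> I\<close>, of "\<lambda>_. V - {v}"] by simp
  also have "\<dots> = (\<Prod>j\<in>J. 1 - p)"
  proof (rule prod.cong[OF refl])
    fix j assume j: "j \<in> J"
    have "Y j -` {v} \<inter> space M \<in> events"
      using meas[OF j] \<open>v \<in> V\<close> by (intro measurable_sets[of _ _ "count_space V"]) auto
    moreover have "Y j -` (V - {v}) \<inter> space M = space M - (Y j -` {v} \<inter> space M)"
      using measurable_space[OF meas[OF j]] by auto
    moreover have "Y j -` {v} \<inter> space M = {x \<in> space M. Y j x = v}"
      by auto
    ultimately show "prob (Y j -` (V - {v}) \<inter> space M) = 1 - p"
      using p[OF j] by (simp add: prob_compl)
  qed
  finally show ?thesis by simp
qed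

text \<open>\<open>A\<close> and \<open>B\<close> may overlap, so the two hitting events need not be
  independent. Their complements are avoidance events, and avoiding \<open>v\<close> on both sets is
  avoidance on \<open>A \<union> B\<close>; each term of inclusion-exclusion is thus a power of
  \<open>1 - p\<close>.\<close>

lemma (in prob_space) prob_hit_both:
  assumes indep: "indep_vars (\<lambda>_. count_space V) Y I" and "A \<subseteq> I" "B \<subseteq> I"
    and fin: "finite A" "finite B" and "v \<in> V"
    and p: "\<And>j. j \<in> A \<union> B \<Longrightarrow> prob {x \<in> space M. Y j x = v} = p"
  shows "{x \<in> space M. (\<exists>a\<in>A. Y a x = v) \<and> (\<exists>b\<in>B. Y b x = v)} \<in> events"
    and "prob {x \<in> space M. (\<exists>a\<in>A. Y a x = v) \<and> (\<exists>b\<in>B. Y b x = v)}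
           = 1 - (1 - p) ^ card A - (1 - p) ^ card B + (1 - p) ^ card (A \<union> B)"
proof -
  define N where "N J = {x \<in> space M. \<forall>j\<in>J. Y j x \<noteq> v}" for J
  have ev: "N J \<in> events" if "finite J" "J \<subseteq> I" for J
  proof -
    have "{x \<in> space M. Y j x \<noteq> v} \<in> events" if "j \<in> J" for j
    proof -
      have meas: "Y j \<in> measurable M (count_space V)"
        using indep that \<open>J \<subseteq> I\<close> by (auto simp: indep_vars_def)
      have "{x \<in> space M. Y j x \<noteq> v} = Y j -` (V - {v}) \<inter> space M"
        using measurable_space[OF meas] by auto
      then show ?thesis
        using measurable_sets[OF meas, of "V - {v}"] by simp
    qed
    then show ?thesis
      unfolding N_def using \<open>finite J\<close> by (intro sets.sets_Collect_finite_All) auto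
  qed
  have prob_N: "prob (N J) = (1 - p) ^ card J" if "J \<subseteq> A \<union> B" for J
    unfolding N_def
    using that assms finite_subset[OF that] by (intro prob_avoid_value[OF indep]) auto
  have evs: "N A \<in> events" "N B \<in> events"
    using assms by (auto intro: ev)
  have eq: "{x \<in> space M. (\<exists>a\<in>A. Y a x = v) \<and> (\<exists>b\<in>B. Y b x = v)} = space M - (N A \<union> N B)"
    by (auto simp: N_def)
  show "{x \<in> space M. (\<exists>a\<in>A. Y a x = v) \<and> (\<exists>b\<in>B. Y b x = v)} \<in> events"
    unfolding eq using evs by auto
  have "N A \<inter> N B = N (A \<union> B)"
    by (auto simp: N_def)
  moreover have "prob (N A \<union> N B) = prob (N A) + prob (N B) - prob (N A \<inter> N B)"
    using evs by (intro measure_Un3) (auto simp: fmeasurable_eq_sets)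
  ultimately have "prob (N A \<union> N B) = (1 - p) ^ card A + (1 - p) ^ card B - (1 - p) ^ card (A \<union> B)"
    by (simp add: prob_N)
  then show "prob {x \<in> space M. (\<exists>a\<in>A. Y a x = v) \<and> (\<exists>b\<in>B. Y b x = v)}
      = 1 - (1 - p) ^ card A - (1 - p) ^ card B + (1 - p) ^ card (A \<union> B)"
    unfolding eq using evs by (simp add: prob_compl)
qed

section \<open>Expectation of the clique number\<close>

lemma measurable_clique_number_empirical_nerve:
  assumes "\<And>j. j \<in> {1..n} \<Longrightarrow> Y j \<in> measurable M (count_space {1..m})"
  shows "(\<lambda>x. real (clique_number (empirical_nerve m n (\<lambda>j. Y j x)))) \<in> borel_measurable M"
proof -
  let ?g = "\<lambda>y. real (clique_number (empirical_nerve m n y))"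
  have "(\<lambda>x. \<lambda>j\<in>{1..n}. Y j x) \<in> measurable M (Pi\<^sub>M {1..n} (\<lambda>_. count_space {1..m}))"
    using assms by (intro measurable_restrict)
  \<comment> \<open>A finite product of finite discrete spaces is discrete, so every real function
    of the restricted tuple is measurable.\<close>
  then have "(\<lambda>x. \<lambda>j\<in>{1..n}. Y j x) \<in> measurable M (count_space ({1..n} \<rightarrow>\<^sub>E {1..m}))"
    by (simp add: count_space_PiM_finite)
  then have "(\<lambda>x. ?g (\<lambda>j\<in>{1..n}. Y j x)) \<in> borel_measurable M"
    by (rule measurable_compose) simp
  moreover have "?g (\<lambda>j\<in>{1..n}. Y j x) = ?g (\<lambda>j. Y j x)" for x
    by (subst empirical_nerve_cong[of n "\<lambda>j\<in>{1..n}. Y j x" "\<lambda>j. Y j x"]) auto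
  ultimately show ?thesis by simp
qed

text \<open>Any index \<open>k\<close> may serve as the common point; the midpoint is chosen only at
  the end.\<close>

lemma (in prob_space) expectation_clique_number_ge:
  assumes indep: "indep_vars (\<lambda>_. count_space {1..m}) Y {1..n}"
    and p: "\<And>i j. i \<in> {1..m} \<Longrightarrow> j \<in> {1..n} \<Longrightarrow> prob {x \<in> space M. Y j x = i} = p i"
    and k: "k \<in> {1..n}"
  shows "(\<Sum>i\<in>{1..m}. 1 - (1 - p i) ^ k - (1 - p i) ^ (n - k + 1) + (1 - p i) ^ n)
           \<le> expectation (\<lambda>x. real (clique_number (empirical_nerve m n (\<lambda>j. Y j x))))"
proof -
  let ?\<omega> = "\<lambda>x. real (clique_number (empirical_nerve m n (\<lambda>j. Y j x)))"
  define G where "G i = {x \<in> space M. (\<exists>a\<in>{1..k}. Y a x = i) \<and> (\<exists>b\<in>{k..n}. Y b x = i)}" for i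
  have union: "{1..k} \<union> {k..n} = {1..n}"
    using k by auto
  have G: "G i \<in> events"
    "prob (G i) = 1 - (1 - p i) ^ k - (1 - p i) ^ (n - k + 1) + (1 - p i) ^ n"
    if "i \<in> {1..m}" for i
    \<comment> \<open>The index \<open>k\<close> is counted in both ranges, hence the exponents
      \<open>k\<close> and \<open>n - k + 1\<close>, while the union has \<open>n\<close>
      elements.\<close>
    using prob_hit_both[OF indep, of "{1..k}" "{k..n}" i "p i", unfolded union] that k p
    by (auto simp: G_def Suc_diff_le)
  have "?\<omega> \<in> borel_measurable M"
    using indep by (intro measurable_clique_number_empirical_nerve) (auto simp: indep_vars_def)
  then have int: "integrable M ?\<omega>"
    by (intro integrable_const_bound[where B = "real m"])
      (auto simp: clique_number_empirical_nerve_le)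
  have "(\<Sum>i\<in>{1..m}. 1 - (1 - p i) ^ k - (1 - p i) ^ (n - k + 1) + (1 - p i) ^ n)
      = (\<Sum>i\<in>{1..m}. prob (G i))"
    by (simp add: G)
  also have "\<dots> = expectation (\<lambda>x. \<Sum>i\<in>{1..m}. indicator (G i) x)"
    by (subst Bochner_Integration.integral_sum) (auto simp: G less_top[symmetric])
  also have "\<dots> \<le> expectation ?\<omega>"
  proof (rule integral_mono[OF _ int])
    show "integrable M (\<lambda>x. \<Sum>i\<in>{1..m}. indicator (G i) x :: real)"
      by (auto simp: G less_top[symmetric])
    fix x assume x: "x \<in> space M"
    \<comment> \<open>Pointwise, the indicators count the labels seen on both sides of
      \<open>k\<close>, and these form a clique.\<close>
    have "(\<Sum>i\<in>{1..m}. indicator (G i) x) = real (card {i \<in> {1..m}. x \<in> G i})"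
      by (simp add: indicator_def sum.If_cases Int_def)
    also have "{i \<in> {1..m}. x \<in> G i}
        = {i \<in> {1..m}. (\<exists>a\<in>{1..k}. Y a x = i) \<and> (\<exists>b\<in>{k..n}. Y b x = i)}"
      using x by (simp add: G_def)
    also have "real (card \<dots>) \<le> ?\<omega> x"
      using clique_number_empirical_nerve_ge[OF k, of m "\<lambda>j. Y j x"] by simp
    finally show "(\<Sum>i\<in>{1..m}. indicator (G i) x) \<le> ?\<omega> x" .
  qed
  finally show ?thesis .
qed

theorem theorem11:
  fixes m n :: nat and p :: "nat \<Rightarrow> real"
    and M :: "'a measure" and Y :: "nat \<Rightarrow> 'a \<Rightarrow> nat"
  assumes "m \<ge> 1" and "n \<ge> 1"
    and "\<And>i. i \<in> {1..m} \<Longrightarrow> p i > 0"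
    and "(\<Sum>i\<in>{1..m}. p i) = 1"
    and "prob_space M"
    and "prob_space.indep_vars M (\<lambda>_. count_space {1..m}) Y {1..n}"
    and "\<And>i j. i \<in> {1..m} \<Longrightarrow> j \<in> {1..n} \<Longrightarrow> \<P>(x in M. Y j x = i) = p i"
  shows "(LINT x|M. real (clique_number (empirical_nerve m n (\<lambda>j. Y j x))))
           \<ge> (\<Sum>i\<in>{1..m}. 1 - (1 - p i) ^ nat \<lceil>real n / 2\<rceil>
                 - (1 - p i) ^ (n - nat \<lceil>real n / 2\<rceil> + 1) + (1 - p i) ^ n)
       \<and> ((\<forall>i\<in>{1..m}. p i = 1 / real m) \<longrightarrow>
         (LINT x|M. real (clique_number (empirical_nerve m n (\<lambda>j. Y j x))))
           \<ge> real m * (1 - ((real m - 1) / real m) ^ nat \<lceil>real n / 2\<rceil>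
                 - ((real m - 1) / real m) ^ (n - nat \<lceil>real n / 2\<rceil> + 1)
                 + ((real m - 1) / real m) ^ n))"
proof -
  let ?k = "nat \<lceil>real n / 2\<rceil>"
  let ?\<omega> = "LINT x|M. real (clique_number (empirical_nerve m n (\<lambda>j. Y j x)))"
  interpret prob_space M by fact
  \<comment> \<open>The lower bound uses \<open>n \<ge> 1\<close>, which makes \<open>n/2\<close>
    positive; the upper one is \<open>n/2 \<le> n\<close>.\<close>
  have "?k \<in> {1..n}"
    using \<open>n \<ge> 1\<close> by (auto simp: le_nat_iff nat_le_iff ceiling_le_iff le_ceiling_iff)
  then have main: "(\<Sum>i\<in>{1..m}. 1 - (1 - p i) ^ ?k - (1 - p i) ^ (n - ?k + 1) + (1 - p i) ^ n) \<le> ?\<omega>"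
    using assms(6,7) by (intro expectation_clique_number_ge)
  moreover have "real m * (1 - ((real m - 1) / real m) ^ ?k
      - ((real m - 1) / real m) ^ (n - ?k + 1) + ((real m - 1) / real m) ^ n) \<le> ?\<omega>"
    if unif: "\<forall>i\<in>{1..m}. p i = 1 / real m"
  proof -
    \<comment> \<open>All summands now coincide, so the sum collapses to \<open>m\<close> times one
      of them.\<close>
    have "1 - p i = (real m - 1) / real m" if "i \<in> {1..m}" for i
      using unif that \<open>m \<ge> 1\<close> by (simp add: field_simps)
    then show ?thesis
      using main by simp
  qed
  ultimately show ?thesis by blast
qed

end
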